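(* Consider Direct Availability-Graded Broadcast (rules R1–R4 of the context) among $n\ge3f+1$ parties, at most $f$ Byzantine, under partial synchrony with known bound $\Delta$ and actual bound $\delta\le\Delta$. Let $s\ge\mathrm{GST}$ be the time of the first correct $\mathsf{enter}(v)$ event, assume every correct party enters $v$ by $s+2\delta$, and assume the view-$v$ proposal is broadcast no earlier than GST. Suppose $\mathsf{Proposer}(v)$ is correct and invokes $\mathsf{propose}(v,C,T)$ with $\mathsf{Formed}_v(C,T)$ no later than time $s+\delta$. Assume that at every correct party $p_i$, $\mathsf{CoreOK}_i(C)$ holds at some instant no later than the closure of its echo window (and hence, by persistence, through the fallback action). Then every correct party fires $\mathsf{complete}(v)$ by time $s+4\delta+\Delta\le s+5\Delta$, returning $B_v=(C,T)$.
   Context: Model. $n\ge 3f+1$ parties $p_1,\dots,p_n$, at most $f$ Byzantine (fixed before the execution), others correct. $Q=n-f$. Channels are reliable and authenticated (the receiver learns the sender; no forging between correct parties). A broadcast includes the sender, which delivers to itself immediately. All counts are over distinct authors of messages received directly from those authors. Partial synchrony: with unknown GST, a message between correct parties sent at time $t$ arrives by $\max(t,\mathrm{GST})+\delta$, where $\delta\le\Delta$ and $\Delta$ is known. After GST local clocks measure elapsed real time without drift. At a local deadline a party processes every message delivered by that deadline, and evaluates the positive rules they enable, before taking the timeout rule. Direct AGB in view $v$, with designated proposer $\mathsf{Proposer}(v)$. A proposal is a pair $B=(C,T)$ (core manifest, tip manifest). The primitive is parameterized by a deterministic syntactic predicate $\mathsf{Formed}_v(C,T)$ and local predicates $\mathsf{CoreOK}_i(C)$,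 $\mathsf{TipOK}_i(C,T)$, which are persistent: once true at a correct party for a fixed proposal, they remain true. Idempotent local environment events $\mathsf{activate}(v)$ and $\mathsf{enter}(v)$ (the latter at time $e_i(v)$ at $p_i$). Constants: $\theta_E=3\Delta$, $\theta_R=4\Delta$. (R1) On its first input $\mathsf{propose}(v,C,T)$ the proposer broadcasts the proposal $(C,T)$ once. (R2) $p_i$ fixes the first view-$v$ proposal received directly from $\mathsf{Proposer}(v)$ and ignores later ones; if it is not formed it is never echoed. A fixed formed proposal is active after $\mathsf{activate}(v)$ or $\mathsf{enter}(v)$. While its echo-stage response is pending and the proposal active, as soon as $\mathsf{CoreOK}_i(C)$ and $\mathsf{TipOK}_i(C,T)$ both hold, $p_i$ broadcasts a grade-1 ECHO of $(C,T)$. After $\mathsf{enter}(v)$, with $t$ the later of entry and direct receipt of the fixed formed proposal, the echo (fallback) window is $[t,\min\{t+\Delta,e_i(v)+\theta_E\}]$; if nothing was sent by its end, $p_i$ broadcasts a grade-0 ECHO of $(C,T)$ if $\mathsf{CoreOK}_i(C)$ holds and $\mathsf{echo\text{-}skip}$ otherwise. If no formed proposal is active by $e_i(v)+\theta_E$ it broadcasts $\mathsf{echo\text{-}skip}$. A correct party sends one echo-stage response per view. (R3) While its initial ready-stage response is pending (independently of entry), upon counting $Q$ ECHOs of any grade naming one $B$, $p_i$ broadcasts READY for $B$ with grade 1 (resp. 0) if it has counted $Q$ grade-1 (resp. grade-0) ECHOs for $B$, else grade mix (a mix READY may later be followed by one homogeneous refinement for the same $B$). If $p_i$ has entered and sent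 no READY by $e_i(v)+\theta_R$ it broadcasts $\mathsf{no\text{-}ready}$. A receiver counts only the first echo-stage and the first ready-stage statement of each author toward quorums that ignore grades. (R4) Upon counting $Q$ READYs for a common $B$, grades ignored, $p_i$ fires $\mathsf{complete}(v)$, returning $B$. *)

theory Defs
  imports Complex_Main
begin

text \<open>
  Parties are the numbers \<open>1, \<dots>, n\<close>, views are natural numbers, real time is \<^typ>\<open>real\<close>.
  A proposal is a pair of a core manifest and a tip manifest.
\<close>

type_synonym party = nat
type_synonym view = nat

datatype echo_grade = G0 | G1

datatype ready_grade = Hom echo_grade | Mix

datatype ('c, 't) msg =
    Proposal view "'c \<times> 't"
  | Echo view echo_grade "'c \<times> 't"
  | EchoSkip view
  | Ready view ready_grade "'c \<times> 't"
  | NoReady view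

fun is_proposal :: "view \<Rightarrow> ('c, 't) msg \<Rightarrow> bool" where
  "is_proposal v (Proposal w B) = (w = v)"
| "is_proposal v _ = False"

fun echo_stage :: "view \<Rightarrow> ('c, 't) msg \<Rightarrow> bool" where
  "echo_stage v (Echo w g B) = (w = v)"
| "echo_stage v (EchoSkip w) = (w = v)"
| "echo_stage v _ = False"

fun ready_stage :: "view \<Rightarrow> ('c, 't) msg \<Rightarrow> bool" where
  "ready_stage v (Ready w g B) = (w = v)"
| "ready_stage v (NoReady w) = (w = v)"
| "ready_stage v _ = False"

text \<open>
  \<open>inbox X i t\<close> lists the messages delivered to \<open>i\<close> up to and including time \<open>t\<close>, in the order
  in which \<open>i\<close> processes them, each with its delivery time and its channel-authenticated sender.
  The order matters only for ``first'' among messages delivered at the same instant.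

  \<open>clock X i t\<close> is the local clock reading of \<open>i\<close> at real time \<open>t\<close>.  \<open>activate_at X v i\<close> and
  \<open>enter_at X v i\<close> are the real times of the first occurrences of the (idempotent) events
  \<open>activate(v)\<close> and \<open>enter(v)\<close> at \<open>i\<close>, and \<open>first_propose X v\<close> is the first \<open>propose\<close> input at the
  proposer of \<open>v\<close>; \<^const>\<open>None\<close> means that there is none.  The local predicates \<open>core_ok\<close> and
  \<open>tip_ok\<close> depend on the state of the party and hence on time.
\<close>

record ('c, 't) agb_execution =
  proposer :: "view \<Rightarrow> party"
  formed :: "view \<Rightarrow> 'c \<Rightarrow> 't \<Rightarrow> bool"
  core_ok :: "party \<Rightarrow> real \<Rightarrow> 'c \<Rightarrow> bool"
  tip_ok :: "party \<Rightarrow> real \<Rightarrow> 'c \<Rightarrow> 't \<Rightarrow> bool"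
  clock :: "party \<Rightarrow> real \<Rightarrow> real"
  activate_at :: "view \<Rightarrow> party \<Rightarrow> real option"
  enter_at :: "view \<Rightarrow> party \<Rightarrow> real option"
  first_propose :: "view \<Rightarrow> (real \<times> 'c \<times> 't) option"
  bcast :: "party \<Rightarrow> (real \<times> ('c, 't) msg) set"
  inbox :: "party \<Rightarrow> real \<Rightarrow> (real \<times> party \<times> ('c, 't) msg) list"
  complete_at :: "view \<Rightarrow> party \<Rightarrow> (real \<times> 'c \<times> 't) option"

definition theta_E :: "real \<Rightarrow> real" where "theta_E \<Delta> = 3 * \<Delta>"

definition theta_R :: "real \<Rightarrow> real" where "theta_R \<Delta> = 4 * \<Delta>"

abbreviation correct :: "nat \<Rightarrow> party set \<Rightarrow> party set" where
  "correct n byz \<equiv> {1..n} - byz"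

subsection \<open>Channels, clocks, local predicates\<close>

definition wf_inbox :: "nat \<Rightarrow> ('c, 't) agb_execution \<Rightarrow> party \<Rightarrow> bool" where
  "wf_inbox n X i \<longleftrightarrow>
     (\<forall>t. sorted (map fst (inbox X i t))) \<and>
     (\<forall>t t'. t \<le> t' \<longrightarrow> inbox X i t = takeWhile (\<lambda>d. fst d \<le> t) (inbox X i t')) \<and>
     (\<forall>t u j m. (u, j, m) \<in> set (inbox X i t) \<longrightarrow> j \<in> {1..n})"

text \<open>
  Only messages between correct parties are constrained: a Byzantine party may send anything,
  to any subset of the parties, but only under its own name.
\<close>

definition channels :: "nat \<Rightarrow> party set \<Rightarrow> real \<Rightarrow> real \<Rightarrow> ('c, 't) agb_execution \<Rightarrow> bool" where
  "channels n byz GST \<delta> X \<longleftrightarrow>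
     (\<forall>i \<in> correct n byz. wf_inbox n X i \<and>
        (\<forall>u m. (u, m) \<in> bcast X i \<longrightarrow> (u, i, m) \<in> set (inbox X i u)) \<and>
        (\<forall>j \<in> correct n byz.
           (\<forall>t r m. (r, j, m) \<in> set (inbox X i t) \<longrightarrow> (\<exists>u \<le> r. (u, m) \<in> bcast X j)) \<and>
           (\<forall>u m. (u, m) \<in> bcast X j \<longrightarrow>
              (\<exists>r. u \<le> r \<and> r \<le> max u GST + \<delta> \<and> (r, j, m) \<in> set (inbox X i r)))))"

definition drift_free_after :: "real \<Rightarrow> (real \<Rightarrow> real) \<Rightarrow> bool" where
  "drift_free_after GST c \<longleftrightarrow>
     mono c \<and> (\<forall>t t'. GST \<le> t \<and> t \<le> t' \<longrightarrow> c t' - c t = t' - t)"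

definition persistent_predicates :: "('c, 't) agb_execution \<Rightarrow> party \<Rightarrow> bool" where
  "persistent_predicates X i \<longleftrightarrow>
     (\<forall>t t' C. t \<le> t' \<and> core_ok X i t C \<longrightarrow> core_ok X i t' C) \<and>
     (\<forall>t t' C T. t \<le> t' \<and> tip_ok X i t C T \<longrightarrow> tip_ok X i t' C T)"

subsection \<open>The protocol rules\<close>

text \<open>
  \<open>P t a\<close> says that action \<open>a\<close> is enabled at time \<open>t\<close> if no action has been taken before, and \<open>S\<close> is
  the set of actions taken.  Exactly one action is taken if one is ever enabled, and it is taken
  at the first instant at which one is enabled.  (Local steps take no time.)
\<close>

definition prompt_once :: "(real \<Rightarrow> 'a \<Rightarrow> bool) \<Rightarrow> (real \<times> 'a) set \<Rightarrow> bool" where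
  "prompt_once P S \<longleftrightarrow>
     (\<forall>x \<in> S. \<forall>y \<in> S. x = y) \<and>
     (\<forall>t a. (t, a) \<in> S \<longrightarrow> P t a) \<and>
     (\<forall>t a. P t a \<longrightarrow> (\<exists>u b. (u, b) \<in> S \<and> u \<le> t))"

definition rule_R1 :: "('c, 't) agb_execution \<Rightarrow> view \<Rightarrow> party \<Rightarrow> bool" where
  "rule_R1 X v i \<longleftrightarrow>
     {(t, m) \<in> bcast X i. is_proposal v m} =
     (if i = proposer X v then {(t, Proposal v B) | t B. first_propose X v = Some (t, B)} else {})"

definition fixed_proposal ::
  "('c, 't) agb_execution \<Rightarrow> view \<Rightarrow> party \<Rightarrow> real \<Rightarrow> (real \<times> 'c \<times> 't) option" where
  "fixed_proposal X v i t =
     (case find (\<lambda>(r, j, m). j = proposer X v \<and> is_proposal v m) (inbox X i t) of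
        Some (r, _, Proposal _ B) \<Rightarrow> Some (r, B)
      | _ \<Rightarrow> None)"

definition active_proposal ::
  "('c, 't) agb_execution \<Rightarrow> view \<Rightarrow> party \<Rightarrow> real \<Rightarrow> (real \<times> 'c \<times> 't) option" where
  "active_proposal X v i t =
     (case fixed_proposal X v i t of
        Some (r, C, T) \<Rightarrow>
          if formed X v C T \<and> (\<exists>a \<le> t. activate_at X v i = Some a \<or> enter_at X v i = Some a)
          then Some (r, C, T) else None
      | None \<Rightarrow> None)"

text \<open>
  The clock reading at which the echo window ends, for entry at real time \<open>e\<close> and direct receipt of
  the fixed formed proposal at real time \<open>r\<close>.  All deadlines are readings of the local clock, which
  advances at the rate of real time only after GST.
\<close>

definition echo_window_end ::
  "real \<Rightarrow> ('c, 't) agb_execution \<Rightarrow> party \<Rightarrow> real \<Rightarrow> real \<Rightarrow> real" where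
  "echo_window_end \<Delta> X i e r =
     min (clock X i (max e r) + \<Delta>) (clock X i e + theta_E \<Delta>)"

definition echo_window_closes ::
  "real \<Rightarrow> ('c, 't) agb_execution \<Rightarrow> view \<Rightarrow> party \<Rightarrow> real \<Rightarrow> bool" where
  "echo_window_closes \<Delta> X v i w \<longleftrightarrow>
     (\<exists>e t r C T. enter_at X v i = Some e \<and> fixed_proposal X v i t = Some (r, C, T) \<and>
        formed X v C T \<and> w = echo_window_end \<Delta> X i e r)"

definition echo_enabled ::
  "('c, 't) agb_execution \<Rightarrow> view \<Rightarrow> party \<Rightarrow> real \<Rightarrow> 'c \<Rightarrow> 't \<Rightarrow> bool" where
  "echo_enabled X v i t C T \<longleftrightarrow>
     (\<exists>r. active_proposal X v i t = Some (r, C, T)) \<and> core_ok X i t C \<and> tip_ok X i t C T"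

definition echo_timeout ::
  "real \<Rightarrow> ('c, 't) agb_execution \<Rightarrow> view \<Rightarrow> party \<Rightarrow> real \<Rightarrow> ('c, 't) msg \<Rightarrow> bool" where
  "echo_timeout \<Delta> X v i t m \<longleftrightarrow>
     (\<exists>e \<le> t. enter_at X v i = Some e \<and>
        (case active_proposal X v i t of
           Some (r, C, T) \<Rightarrow>
             echo_window_end \<Delta> X i e r \<le> clock X i t \<and>
             m = (if core_ok X i t C then Echo v G0 (C, T) else EchoSkip v)
         | None \<Rightarrow>
             clock X i e + theta_E \<Delta> \<le> clock X i t \<and> m = EchoSkip v))"

definition echo_response ::
  "real \<Rightarrow> ('c, 't) agb_execution \<Rightarrow> view \<Rightarrow> party \<Rightarrow> real \<Rightarrow> ('c, 't) msg \<Rightarrow> bool" where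
  "echo_response \<Delta> X v i t m \<longleftrightarrow>
     (\<exists>C T. echo_enabled X v i t C T \<and> m = Echo v G1 (C, T)) \<or>
     (\<nexists>C T. echo_enabled X v i t C T) \<and> echo_timeout \<Delta> X v i t m"

definition rule_R2 :: "real \<Rightarrow> ('c, 't) agb_execution \<Rightarrow> view \<Rightarrow> party \<Rightarrow> bool" where
  "rule_R2 \<Delta> X v i \<longleftrightarrow>
     prompt_once (echo_response \<Delta> X v i) {(t, m) \<in> bcast X i. echo_stage v m}"

text \<open>
  In the following, \<open>L\<close> is an initial segment of an inbox and \<open>Q\<close> the quorum size.  Quorums that
  ignore grades count only the first statement of each author in the stage; quorums for a specific
  grade count every author of such a statement (an author may refine a \<^const>\<open>Mix\<close> READY).
\<close>

definition echo_quorum ::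
  "nat \<Rightarrow> view \<Rightarrow> (real \<times> party \<times> ('c, 't) msg) list \<Rightarrow> 'c \<times> 't \<Rightarrow> bool" where
  "echo_quorum Q v L B \<longleftrightarrow>
     Q \<le> card {j. \<exists>r g. find (\<lambda>(_, k, m). k = j \<and> echo_stage v m) L = Some (r, j, Echo v g B)}"

definition graded_echo_quorum ::
  "nat \<Rightarrow> view \<Rightarrow> (real \<times> party \<times> ('c, 't) msg) list \<Rightarrow> echo_grade \<Rightarrow> 'c \<times> 't \<Rightarrow> bool" where
  "graded_echo_quorum Q v L g B \<longleftrightarrow> Q \<le> card {j. \<exists>r. (r, j, Echo v g B) \<in> set L}"

definition ready_quorum ::
  "nat \<Rightarrow> view \<Rightarrow> (real \<times> party \<times> ('c, 't) msg) list \<Rightarrow> 'c \<times> 't \<Rightarrow> bool" where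
  "ready_quorum Q v L B \<longleftrightarrow>
     Q \<le> card {j. \<exists>r g. find (\<lambda>(_, k, m). k = j \<and> ready_stage v m) L = Some (r, j, Ready v g B)}"

definition grade_of_ready ::
  "nat \<Rightarrow> view \<Rightarrow> (real \<times> party \<times> ('c, 't) msg) list \<Rightarrow> 'c \<times> 't \<Rightarrow> ready_grade" where
  "grade_of_ready Q v L B =
     (if graded_echo_quorum Q v L G1 B then Hom G1
      else if graded_echo_quorum Q v L G0 B then Hom G0
      else Mix)"

text \<open>
  READY may be sent after processing only some (\<open>take k\<close>) of the messages delivered at the current
  instant; the timeout is taken only after processing all of them.
\<close>

definition ready_response ::
  "nat \<Rightarrow> real \<Rightarrow> ('c, 't) agb_execution \<Rightarrow> view \<Rightarrow> party \<Rightarrow> real \<Rightarrow> ('c, 't) msg \<Rightarrow> bool" where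
  "ready_response Q \<Delta> X v i t m \<longleftrightarrow>
     (\<exists>k B. let L = take k (inbox X i t) in
        echo_quorum Q v L B \<and> m = Ready v (grade_of_ready Q v L B) B) \<or>
     (\<nexists>B. echo_quorum Q v (inbox X i t) B) \<and>
     (\<exists>e \<le> t. enter_at X v i = Some e \<and> clock X i e + theta_R \<Delta> \<le> clock X i t) \<and>
     m = NoReady v"

definition rule_R3 :: "nat \<Rightarrow> real \<Rightarrow> ('c, 't) agb_execution \<Rightarrow> view \<Rightarrow> party \<Rightarrow> bool" where
  "rule_R3 Q \<Delta> X v i \<longleftrightarrow>
     (\<exists>I. prompt_once (ready_response Q \<Delta> X v i) I \<and>
        ({(t, m) \<in> bcast X i. ready_stage v m} = I \<or>
         (\<exists>t t' g B. I = {(t, Ready v Mix B)} \<and> t \<le> t' \<and>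
            graded_echo_quorum Q v (inbox X i t') g B \<and>
            {(t, m) \<in> bcast X i. ready_stage v m} = I \<union> {(t', Ready v (Hom g) B)})))"

definition rule_R4 :: "nat \<Rightarrow> ('c, 't) agb_execution \<Rightarrow> view \<Rightarrow> party \<Rightarrow> bool" where
  "rule_R4 Q X v i \<longleftrightarrow>
     prompt_once (\<lambda>t B. ready_quorum Q v (inbox X i t) B) (set_option (complete_at X v i))"

definition direct_agb_execution ::
  "nat \<Rightarrow> nat \<Rightarrow> party set \<Rightarrow> real \<Rightarrow> real \<Rightarrow> real \<Rightarrow> ('c, 't) agb_execution \<Rightarrow> view \<Rightarrow> bool" where
  "direct_agb_execution n f byz GST \<delta> \<Delta> X v \<longleftrightarrow>
     channels n byz GST \<delta> X \<and>
     proposer X v \<in> {1..n} \<and>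
     (\<forall>i \<in> correct n byz.
        drift_free_after GST (clock X i) \<and> persistent_predicates X i \<and>
        rule_R1 X v i \<and> rule_R2 \<Delta> X v i \<and> rule_R3 (n - f) \<Delta> X v i \<and> rule_R4 (n - f) X v i)"

end

theory Submission
  imports Defs
begin

text \<open>
  Every correct party fixes the proposal by \<open>s + 2\<delta>\<close>, so its echo window ends by \<open>s + 2\<delta> + \<Delta>\<close>
  and, the core being available by then, its only echo-stage statement is an ECHO of \<open>(C, T)\<close>.
  Once all correct parties make the same statement, it is the only one that can gather a quorum,
  because \<open>n - f > f\<close>; and it does gather one \<open>\<delta>\<close> later.  Applied to the echo stage this makes
  \<open>(C, T)\<close> the only READY value, sent by \<open>s + 3\<delta> + \<Delta>\<close>; applied to the ready stage it gives
  completion by \<open>s + 4\<delta> + \<Delta>\<close>.  The ready deadline cannot interfere: it is at least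
  \<open>s + 4\<Delta>\<close>, and messages delivered at the deadline are processed before the timeout.
\<close>

section \<open>List search and quorum counting\<close>

lemma prompt_once_enabled: "prompt_once P S \<Longrightarrow> (t, a) \<in> S \<Longrightarrow> P t a"
  unfolding prompt_once_def by simp

lemma find_SomeD: "find P xs = Some x \<Longrightarrow> x \<in> set xs \<and> P x"
  by (induction xs) (auto split: if_splits)

lemma find_append: "find P (xs @ ys) = (case find P xs of None \<Rightarrow> find P ys | Some x \<Rightarrow> Some x)"
  by (induction xs) auto

lemma find_eq_Some:
  assumes "x \<in> set xs" "P x"
  obtains y where "find P xs = Some y"
  using assms by (metis find_None_iff not_None_eq)

text \<open>Since \<open>n - f \<ge> 2 * f + 1 > card byz\<close>, a quorum cannot fit inside
  \<open>byz\<close>. When the correct parties are unanimous, this single correct author settles the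
  value.\<close>

lemma quorum_of_correct:
  assumes "n - f \<le> card A" "A \<subseteq> {1..n}" "3 * f + 1 \<le> n" "card byz \<le> f" "byz \<subseteq> {1..n}"
  obtains j where "j \<in> A" "j \<in> correct n byz"
proof -
  have "finite byz"
    using assms(5) finite_subset by blast
  then have "\<not> A \<subseteq> byz"
    using card_mono[of byz A] assms by linarith
  then show thesis
    using that assms(2) by blast
qed

text \<open>At most \<open>f\<close> parties are removed from \<open>{1..n}\<close>, so the correct
  ones form a quorum without Byzantine cooperation.\<close>

lemma correct_is_quorum:
  assumes "correct n byz \<subseteq> A" "A \<subseteq> {1..n}" "card byz \<le> f" "byz \<subseteq> {1..n}"
  shows "n - f \<le> card A"
proof -
  have "n - f \<le> card (correct n byz)"
    using assms by (simp add: card_Diff_subset finite_subset)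
  also have "\<dots> \<le> card A"
    using assms by (meson card_mono finite_atLeastAtMost finite_subset)
  finally show ?thesis .
qed

subsection \<open>Channels\<close>

text \<open>The earlier inbox is a \<open>takeWhile\<close> of the later one, so inboxes grow only
  at the end. This keeps membership and the first hit of a \<open>find\<close> stable over
  time.\<close>

lemma inbox_append:
  assumes "wf_inbox n X i" "t \<le> t'"
  obtains L where "inbox X i t' = inbox X i t @ L"
  using assms unfolding wf_inbox_def by (metis takeWhile_dropWhile_id)

lemma inbox_time:
  assumes "wf_inbox n X i" "(r, j, m) \<in> set (inbox X i t)"
  shows "r \<le> t"
proof -
  have "inbox X i t = takeWhile (\<lambda>d. fst d \<le> t) (inbox X i t)"
    using assms(1) unfolding wf_inbox_def by blast
  then have "(r, j, m) \<in> set (takeWhile (\<lambda>d. fst d \<le> t) (inbox X i t))"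
    using assms(2) by simp
  then show ?thesis
    by (auto dest: set_takeWhileD)
qed

lemma delivery:
  assumes "channels n byz GST \<delta> X" "i \<in> correct n byz" "j \<in> correct n byz"
    and "(u, m) \<in> bcast X j" "max u GST + \<delta> \<le> t"
  obtains r where "(r, j, m) \<in> set (inbox X i t)"
proof -
  obtain r where r: "r \<le> max u GST + \<delta>" "(r, j, m) \<in> set (inbox X i r)"
    using assms unfolding channels_def by blast
  have "wf_inbox n X i"
    using assms unfolding channels_def by blast
  then obtain L where "inbox X i t = inbox X i r @ L"
    using inbox_append r(1) assms(5) by (metis order_trans)
  then have "(r, j, m) \<in> set (inbox X i t)"
    using r(2) by simp
  then show thesis
    using that by blast
qed

lemma origin:
  assumes "channels n byz GST \<delta> X" "i \<in> correct n byz" "j \<in> correct n byz"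
    and "(r, j, m) \<in> set (inbox X i t)"
  obtains u where "u \<le> r" "(u, m) \<in> bcast X j"
  using assms unfolding channels_def by blast

subsection \<open>Quorums of unanimous stages\<close>

text \<open>
  The common form of \<^const>\<open>echo_quorum\<close> and \<^const>\<open>ready_quorum\<close>: \<open>p\<close> recognizes the statements of
  the stage, and \<open>K g B\<close> is the statement for \<open>B\<close> with grade \<open>g\<close>.
\<close>

definition stage_authors ::
  "(('c, 't) msg \<Rightarrow> bool) \<Rightarrow> ('g \<Rightarrow> 'c \<times> 't \<Rightarrow> ('c, 't) msg) \<Rightarrow>
   (real \<times> party \<times> ('c, 't) msg) list \<Rightarrow> 'c \<times> 't \<Rightarrow> party set" where
  "stage_authors p K L B =
     {j. \<exists>r g. find (\<lambda>(_, k, m). k = j \<and> p m) L = Some (r, j, K g B)}"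

lemma stage_authors_subset:
  assumes "wf_inbox n X i"
  shows "stage_authors p K (take k (inbox X i t)) B \<subseteq> {1..n}"
proof
  fix j assume "j \<in> stage_authors p K (take k (inbox X i t)) B"
  then obtain r g where "(r, j, K g B) \<in> set (inbox X i t)"
    unfolding stage_authors_def by (blast dest: find_SomeD in_set_takeD)
  then show "j \<in> {1..n}"
    using assms unfolding wf_inbox_def by blast
qed

text \<open>Some author in the quorum is correct; authenticity traces its counted statement to a
  real broadcast, which by unanimity names \<open>B\<close>. The form with \<open>take k\<close>
  covers a READY sent after only part of the messages of an instant have been processed; a large
  \<open>k\<close> gives the whole inbox.\<close>

lemma unanimous_quorum_unique:
  assumes "3 * f + 1 \<le> n" "byz \<subseteq> {1..n}" "card byz \<le> f"
    and ch: "channels n byz GST \<delta> X" "i \<in> correct n byz"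
    and inj: "\<And>g g' B B'. K g B = K g' B' \<Longrightarrow> B = B'"
    and unanimous: "\<And>j u m. j \<in> correct n byz \<Longrightarrow> (u, m) \<in> bcast X j \<Longrightarrow> p m \<Longrightarrow> \<exists>g. m = K g B"
    and quorum: "n - f \<le> card (stage_authors p K (take k (inbox X i t)) B')"
  shows "B' = B"
proof -
  have "wf_inbox n X i"
    using ch unfolding channels_def by blast
  then obtain j where j: "j \<in> stage_authors p K (take k (inbox X i t)) B'" "j \<in> correct n byz"
    using quorum_of_correct[OF quorum stage_authors_subset] assms(1-3) by metis
  from j(1) obtain r g where
    find: "find (\<lambda>(_, k, m). k = j \<and> p m) (take k (inbox X i t)) = Some (r, j, K g B')"
    unfolding stage_authors_def by blast
  have "(r, j, K g B') \<in> set (inbox X i t)" "p (K g B')"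
    using find_SomeD[OF find] by (auto dest: in_set_takeD)
  then show ?thesis
    using origin[OF ch j(2)] unanimous[OF j(2)] inj by metis
qed

lemma unanimous_quorum_reached:
  assumes "byz \<subseteq> {1..n}" "card byz \<le> f"
    and ch: "channels n byz GST \<delta> X" "i \<in> correct n byz"
    and unanimous: "\<And>j u m. j \<in> correct n byz \<Longrightarrow> (u, m) \<in> bcast X j \<Longrightarrow> p m \<Longrightarrow> \<exists>g. m = K g B"
    and sent: "\<And>j. j \<in> correct n byz \<Longrightarrow> \<exists>u m. (u, m) \<in> bcast X j \<and> p m \<and> u \<le> b"
    and late: "GST \<le> b" "b + \<delta> \<le> t"
  shows "n - f \<le> card (stage_authors p K (inbox X i t) B)"
proof (rule correct_is_quorum)
  have "wf_inbox n X i"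
    using ch unfolding channels_def by blast
  then show "stage_authors p K (inbox X i t) B \<subseteq> {1..n}"
    using stage_authors_subset[of n X i p K "length (inbox X i t)" t B] by simp
  show "correct n byz \<subseteq> stage_authors p K (inbox X i t) B"
  proof
    fix j assume j: "j \<in> correct n byz"
    let ?P = "\<lambda>(_ :: real, k, m). k = j \<and> p m"
    obtain u m where um: "(u, m) \<in> bcast X j" "p m" "u \<le> b"
      using sent[OF j] by blast
    have "max u GST + \<delta> \<le> t"
      using um(3) late by linarith
    then obtain r where "(r, j, m) \<in> set (inbox X i t)"
      using delivery[OF ch j um(1)] by blast
    \<comment> \<open>The first statement of \<open>j\<close> in the inbox may differ from the
      delivered \<open>m\<close>, as with a refined READY, but it also stems from \<open>j\<close>
      and hence names \<open>B\<close>.\<close>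
    then obtain r' j' m' where find: "find ?P (inbox X i t) = Some (r', j', m')"
      by (cases rule: find_eq_Some[of "(r, j, m)" "inbox X i t" ?P]) (use um(2) in auto)
    then have m': "j' = j" "p m'" "(r', j, m') \<in> set (inbox X i t)"
      using find_SomeD[OF find] by auto
    then obtain g where "m' = K g B"
      using origin[OF ch j m'(3)] unanimous[OF j] by metis
    then show "j \<in> stage_authors p K (inbox X i t) B"
      unfolding stage_authors_def using find m'(1) by blast
  qed
qed fact+

lemma echo_quorum_stage_authors:
  "echo_quorum Q v L B \<longleftrightarrow> Q \<le> card (stage_authors (echo_stage v) (Echo v) L B)"
  by (simp add: echo_quorum_def stage_authors_def)

lemma ready_quorum_stage_authors:
  "ready_quorum Q v L B \<longleftrightarrow> Q \<le> card (stage_authors (ready_stage v) (Ready v) L B)"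
  by (simp add: ready_quorum_def stage_authors_def)

subsection \<open>Echo stage\<close>

lemma fixed_proposal_SomeD:
  assumes "fixed_proposal X v i t = Some (r, B)"
  shows "(r, proposer X v, Proposal v B) \<in> set (inbox X i t)"
  using assms unfolding fixed_proposal_def
  by (auto split: option.splits msg.splits dest!: find_SomeD)

lemma fixed_proposal_eq_Some:
  assumes "(r, proposer X v, Proposal v B) \<in> set (inbox X i t)"
  obtains r' B' where "fixed_proposal X v i t = Some (r', B')"
proof -
  let ?P = "\<lambda>(_ :: real, j, m). j = proposer X v \<and> is_proposal v m"
  obtain r' j m where find: "find ?P (inbox X i t) = Some (r', j, m)"
    using assms
    by (cases rule: find_eq_Some[of "(r, proposer X v, Proposal v B)" "inbox X i t" ?P]) auto
  then have "is_proposal v m"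
    using find_SomeD[OF find] by auto
  then show thesis
    using that find unfolding fixed_proposal_def by (cases m) auto
qed

lemma fixed_proposal_mono:
  assumes "wf_inbox n X i" "t \<le> t'" "fixed_proposal X v i t = Some x"
  shows "fixed_proposal X v i t' = Some x"
proof -
  obtain L where L: "inbox X i t' = inbox X i t @ L"
    using inbox_append[OF assms(1,2)] by blast
  then show ?thesis
    using assms(3) unfolding fixed_proposal_def L find_append by (auto split: option.splits)
qed

section \<open>Local clocks after GST, and the echo response\<close>

lemma clock_less_iff:
  assumes "drift_free_after GST c" "GST \<le> t"
  shows "c t < c t' \<longleftrightarrow> t < t'"
proof
  assume "c t < c t'"
  then show "t < t'"
    using assms unfolding drift_free_after_def by (meson monoD not_le)
next
  assume "t < t'"
  then have "c t' - c t = t' - t"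
    using assms unfolding drift_free_after_def by auto
  then show "c t < c t'"
    using \<open>t < t'\<close> by simp
qed

lemma clock_diff:
  assumes "drift_free_after GST c" "GST \<le> t" "t \<le> t'"
  shows "c t' = c t + (t' - t)"
  using assms unfolding drift_free_after_def by (metis add.commute diff_add_cancel)

lemma active_proposal_Some_iff:
  "active_proposal X v i t = Some (r, C, T) \<longleftrightarrow>
     fixed_proposal X v i t = Some (r, C, T) \<and> formed X v C T \<and>
     (\<exists>a \<le> t. activate_at X v i = Some a \<or> enter_at X v i = Some a)"
  unfolding active_proposal_def by (auto split: option.splits)

text \<open>By time \<open>d\<close> the party has entered and fixed the proposal, so the echo
  window opens by \<open>d\<close>. A skip could come only from a missing active proposal or a
  missing core: the first is excluded since the clock does not reach the entry deadline before
  \<open>d\<close>, the second by persistence.\<close>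

lemma echo_response_in_time:
  assumes wf: "wf_inbox n X i" and drift: "drift_free_after GST (clock X i)"
    and persistent: "persistent_predicates X i" and R2: "rule_R2 \<Delta> X v i"
    and delays: "0 \<le> \<Delta>" "d \<le> e + 3 * \<Delta>"
    and enter: "enter_at X v i = Some e" "GST \<le> e" "e \<le> d"
    and fixed: "fixed_proposal X v i d = Some (r, C, T)" "formed X v C T"
    and only: "\<And>t r' B. fixed_proposal X v i t = Some (r', B) \<Longrightarrow> B = (C, T)"
    and core: "\<And>w. echo_window_closes \<Delta> X v i w \<Longrightarrow> \<exists>\<tau>. clock X i \<tau> \<le> w \<and> core_ok X i \<tau> C"
  shows "\<exists>u m. (u, m) \<in> bcast X i \<and> echo_stage v m \<and> u \<le> d + \<Delta>"
    and "(u, m) \<in> bcast X i \<Longrightarrow> echo_stage v m \<Longrightarrow> \<exists>g. m = Echo v g (C, T)"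
proof -
  have r: "r \<le> d"
    using inbox_time[OF wf fixed_proposal_SomeD[OF fixed(1)]] .
  have fixed': "fixed_proposal X v i t = Some (r, C, T)" if "d \<le> t" for t
    using fixed_proposal_mono[OF wf that fixed(1)] .
  have active: "active_proposal X v i t = Some (r, C, T)" if "d \<le> t" for t
    using fixed'[OF that] fixed(2) enter(1,3) that order_trans
    unfolding active_proposal_Some_iff by blast
  let ?W = "d + \<Delta>"
  \<comment> \<open>The window end is a clock reading, so the comparison is made on the clock: it
    opens no later than the reading at \<open>d\<close>, and exactly \<open>\<Delta>\<close> elapses
    on the clock after \<open>d\<close>.\<close>
  have "clock X i (max e r) \<le> clock X i d"
    using drift r enter(3) unfolding drift_free_after_def by (simp add: monoD)
  moreover have "clock X i ?W = clock X i d + \<Delta>"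
    using clock_diff[OF drift, of d ?W] enter delays by simp
  ultimately have "echo_window_end \<Delta> X i e r \<le> clock X i ?W"
    unfolding echo_window_end_def by simp
  then have "\<exists>m. echo_timeout \<Delta> X v i ?W m"
    unfolding echo_timeout_def using enter delays active[of ?W] by auto
  \<comment> \<open>If a grade-1 ECHO is enabled it takes precedence, otherwise the timeout applies.
    The response actually sent may be another one, but it is sent no later.\<close>
  then have "\<exists>m. echo_response \<Delta> X v i ?W m"
    unfolding echo_response_def by blast
  then show "\<exists>u m. (u, m) \<in> bcast X i \<and> echo_stage v m \<and> u \<le> ?W"
    using R2 unfolding rule_R2_def prompt_once_def by blast
  assume "(u, m) \<in> bcast X i" "echo_stage v m"
  then have "echo_response \<Delta> X v i u m"
    using prompt_once_enabled[OF R2[unfolded rule_R2_def]] by blast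
  then consider C' T' where "echo_enabled X v i u C' T'" "m = Echo v G1 (C', T')"
    | "echo_timeout \<Delta> X v i u m"
    unfolding echo_response_def by blast
  then show "\<exists>g. m = Echo v g (C, T)"
  proof cases
    case 1
    then show ?thesis
      using only unfolding echo_enabled_def active_proposal_Some_iff by blast
  next
    case 2
    then have u: "e \<le> u"
      using enter unfolding echo_timeout_def by auto
    show ?thesis
    proof (cases "active_proposal X v i u")
      case None
      then have "clock X i e + 3 * \<Delta> \<le> clock X i u"
        using 2 enter unfolding echo_timeout_def theta_E_def by auto
      then have "d \<le> u"
        using clock_diff[OF drift enter(2) u] delays by simp
      then show ?thesis
        using active None by simp
    next
      case (Some x)
      then obtain r' where act: "active_proposal X v i u = Some (r', C, T)"
        using only by (metis active_proposal_Some_iff prod.inject surj_pair)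
      then have closed: "echo_window_end \<Delta> X i e r' \<le> clock X i u"
        and m: "m = (if core_ok X i u C then Echo v G0 (C, T) else EchoSkip v)"
        using 2 enter unfolding echo_timeout_def by auto
      have "echo_window_closes \<Delta> X v i (echo_window_end \<Delta> X i e r')"
        using act enter unfolding active_proposal_Some_iff echo_window_closes_def by blast
      then obtain \<tau> where \<tau>: "clock X i \<tau> \<le> clock X i u" "core_ok X i \<tau> C"
        using core closed by (meson order_trans)
      \<comment> \<open>The instant \<open>\<tau>\<close> may precede GST, where the clock can
        drift; it suffices that \<open>u\<close> does not.\<close>
      have "\<tau> \<le> u"
        using clock_less_iff[OF drift, of u \<tau>] enter(2) u \<tau>(1) by linarith
      then have "core_ok X i u C"
        using persistent \<tau>(2) unfolding persistent_predicates_def by blast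
      then show ?thesis
        using m by simp
    qed
  qed
qed

subsection \<open>Ready stage\<close>

text \<open>The quorum for \<open>B\<close> is present from \<open>d\<close> on, and
  \<open>d\<close> is no later than the ready deadline. By \<open>only\<close>, no other value can
  win even in a partly processed inbox. The initial response is therefore a READY for
  \<open>B\<close>, and a refinement inherits its value.\<close>

lemma ready_response_in_time:
  assumes drift: "drift_free_after GST (clock X i)" and R3: "rule_R3 Q \<Delta> X v i"
    and enter: "enter_at X v i = Some e" "GST \<le> e" "d \<le> e + 4 * \<Delta>"
    and only: "\<And>t k B'. echo_quorum Q v (take k (inbox X i t)) B' \<Longrightarrow> B' = B"
    and reached: "\<And>t. d \<le> t \<Longrightarrow> echo_quorum Q v (inbox X i t) B"
  shows "\<exists>u m. (u, m) \<in> bcast X i \<and> ready_stage v m \<and> u \<le> d"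
    and "(u, m) \<in> bcast X i \<Longrightarrow> ready_stage v m \<Longrightarrow> \<exists>g. m = Ready v g B"
proof -
  let ?S = "{(t, m) \<in> bcast X i. ready_stage v m}"
  obtain I where I: "prompt_once (ready_response Q \<Delta> X v i) I"
    and S: "?S = I \<or> (\<exists>t t' g B. I = {(t, Ready v Mix B)} \<and> t \<le> t' \<and>
      graded_echo_quorum Q v (inbox X i t') g B \<and> ?S = I \<union> {(t', Ready v (Hom g) B)})"
    using R3 unfolding rule_R3_def by (elim exE conjE) (rule that)
  have ready: "\<exists>g. m = Ready v g B" if "(u, m) \<in> I" for u m
  proof -
    have "ready_response Q \<Delta> X v i u m"
      using prompt_once_enabled[OF I that] .
    then consider k B' where "echo_quorum Q v (take k (inbox X i u)) B'"
        "m = Ready v (grade_of_ready Q v (take k (inbox X i u)) B') B'"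
      | "\<nexists>B. echo_quorum Q v (inbox X i u) B" "e \<le> u" "clock X i e + 4 * \<Delta> \<le> clock X i u"
      unfolding ready_response_def Let_def theta_R_def using enter(1) by auto
    then show ?thesis
    proof cases
      case 1
      then show ?thesis
        using only by blast
    next
      case 2
      \<comment> \<open>Even \<open>u = d\<close> is contradictory: the timeout presupposes that the
        full inbox of the instant contains no quorum.\<close>
      then have "d \<le> u"
        using clock_diff[OF drift enter(2) 2(2)] enter(3) by simp
      then show ?thesis
        using reached 2(1) by blast
    qed
  qed
  have "echo_quorum Q v (take (length (inbox X i d)) (inbox X i d)) B"
    using reached[of d] by simp
  then have "\<exists>m. ready_response Q \<Delta> X v i d m"
    unfolding ready_response_def Let_def by blast
  then obtain u' m' where "(u', m') \<in> I" "u' \<le> d"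
    using I unfolding prompt_once_def by blast
  moreover have "I \<subseteq> ?S"
    using S by blast
  ultimately show "\<exists>u m. (u, m) \<in> bcast X i \<and> ready_stage v m \<and> u \<le> d"
    by blast
  assume "(u, m) \<in> bcast X i" "ready_stage v m"
  then have um: "(u, m) \<in> ?S"
    by blast
  from S show "\<exists>g. m = Ready v g B"
  proof
    assume "?S = I"
    then show ?thesis
      using um ready by blast
  next
    assume "\<exists>t t' g B. I = {(t, Ready v Mix B)} \<and> t \<le> t' \<and>
      graded_echo_quorum Q v (inbox X i t') g B \<and> ?S = I \<union> {(t', Ready v (Hom g) B)}"
    then obtain t t' g B' where I': "I = {(t, Ready v Mix B')}" "?S = I \<union> {(t', Ready v (Hom g) B')}"
      by blast
    then have "B' = B"
      using ready[of t "Ready v Mix B'"] by simp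
    then show ?thesis
      using um unfolding I' by blast
  qed
qed

section \<open>Timed chain from the proposal to completion\<close>

theorem theoremB8:
  fixes n f :: nat and byz :: "party set" and GST \<delta> \<Delta> s tp :: real
    and X :: "('c, 't) agb_execution" and v :: view and C :: 'c and T :: 't
  assumes resilience: "n \<ge> 3 * f + 1" "byz \<subseteq> {1..n}" "card byz \<le> f"
    and delays: "0 \<le> \<delta>" "\<delta> \<le> \<Delta>"
    and execution: "direct_agb_execution n f byz GST \<delta> \<Delta> X v"
    and first_entry: "\<exists>i \<in> correct n byz. enter_at X v i = Some s"
      "\<forall>i \<in> correct n byz. \<forall>e. enter_at X v i = Some e \<longrightarrow> s \<le> e"
    and after_GST: "GST \<le> s"
    and all_enter: "\<forall>i \<in> correct n byz. \<exists>e \<le> s + 2 * \<delta>. enter_at X v i = Some e"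
    and correct_proposer: "proposer X v \<in> correct n byz"
    and propose: "first_propose X v = Some (tp, C, T)" "formed X v C T" "tp \<le> s + \<delta>"
    and broadcast_after_GST:
      "\<forall>t B. (t, Proposal v B) \<in> bcast X (proposer X v) \<longrightarrow> GST \<le> t"
    and core_available:
      "\<forall>i \<in> correct n byz. \<forall>w. echo_window_closes \<Delta> X v i w \<longrightarrow>
         (\<exists>\<tau>. clock X i \<tau> \<le> w \<and> core_ok X i \<tau> C)"
  shows "(\<forall>i \<in> correct n byz. \<exists>t \<le> s + 4 * \<delta> + \<Delta>. complete_at X v i = Some (t, C, T)) \<and>
         s + 4 * \<delta> + \<Delta> \<le> s + 5 * \<Delta>"
proof -
  let ?C = "correct n byz"
  have ch: "channels n byz GST \<delta> X"
    using execution unfolding direct_agb_execution_def by blast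
  have rules: "wf_inbox n X i" "drift_free_after GST (clock X i)" "persistent_predicates X i"
    "rule_R2 \<Delta> X v i" "rule_R3 (n - f) \<Delta> X v i" "rule_R4 (n - f) X v i" if "i \<in> ?C" for i
    using execution ch that unfolding direct_agb_execution_def channels_def by blast+
  have enter: "\<exists>e. enter_at X v i = Some e \<and> s \<le> e \<and> e \<le> s + 2 * \<delta>" if "i \<in> ?C" for i
    using first_entry(2) all_enter that by blast
  have proposals: "{(t, m) \<in> bcast X (proposer X v). is_proposal v m} = {(tp, Proposal v (C, T))}"
    using execution correct_proposer propose(1)
    unfolding direct_agb_execution_def rule_R1_def by auto
  have only: "B = (C, T)" if i: "i \<in> ?C" and B: "fixed_proposal X v i t = Some (r, B)" for i t r B
  proof -
    obtain u where "(u, Proposal v B) \<in> bcast X (proposer X v)"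
      using origin[OF ch i correct_proposer fixed_proposal_SomeD[OF B]] by blast
    then have "(u, Proposal v B) \<in> {(t, m) \<in> bcast X (proposer X v). is_proposal v m}"
      by simp
    then show ?thesis
      unfolding proposals by simp
  qed
  have sent: "(tp, Proposal v (C, T)) \<in> bcast X (proposer X v)"
    using proposals by blast
  then have "GST \<le> tp"
    using broadcast_after_GST by blast
  \<comment> \<open>The proposal thus reaches every correct party by the same instant by which all
    have entered; this is the \<open>d\<close> of the echo stage.\<close>
  then have tp: "max tp GST + \<delta> \<le> s + 2 * \<delta>"
    using propose(3) by simp
  have fixed: "\<exists>r. fixed_proposal X v i (s + 2 * \<delta>) = Some (r, C, T)" if i: "i \<in> ?C" for i
    using delivery[OF ch i correct_proposer sent tp] fixed_proposal_eq_Some only[OF i] by metis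
  have echo_sent: "\<exists>u m. (u, m) \<in> bcast X i \<and> echo_stage v m \<and> u \<le> s + 2 * \<delta> + \<Delta>"
    and echo_unanimous: "(u, m) \<in> bcast X i \<Longrightarrow> echo_stage v m \<Longrightarrow> \<exists>g. m = Echo v g (C, T)"
    if i: "i \<in> ?C" for i u m
  proof -
    obtain e where e: "enter_at X v i = Some e" "s \<le> e" "e \<le> s + 2 * \<delta>"
      using enter[OF i] by blast
    have "GST \<le> e" "0 \<le> \<Delta>" "s + 2 * \<delta> \<le> e + 3 * \<Delta>"
      using e after_GST delays by linarith+
    moreover obtain r where "fixed_proposal X v i (s + 2 * \<delta>) = Some (r, C, T)"
      using fixed[OF i] by blast
    moreover have "\<exists>\<tau>. clock X i \<tau> \<le> w \<and> core_ok X i \<tau> C" if "echo_window_closes \<Delta> X v i w" for w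
      using core_available i that by blast
    ultimately show "\<exists>u m. (u, m) \<in> bcast X i \<and> echo_stage v m \<and> u \<le> s + 2 * \<delta> + \<Delta>"
      and "(u, m) \<in> bcast X i \<Longrightarrow> echo_stage v m \<Longrightarrow> \<exists>g. m = Echo v g (C, T)"
      using echo_response_in_time[where d = "s + 2 * \<delta>", OF rules(1-4)[OF i]] e(1,3) propose(2)
        only[OF i] by blast+
  qed
  have echo_unique: "B = (C, T)"
    if "i \<in> ?C" "echo_quorum (n - f) v (take k (inbox X i t)) B" for i k t B
    by (rule unanimous_quorum_unique[where p = "echo_stage v" and K = "Echo v",
          OF resilience ch that(1) _ echo_unanimous
          that(2)[unfolded echo_quorum_stage_authors]]) simp_all
  have echo_reached: "echo_quorum (n - f) v (inbox X i t) (C, T)"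
    if "i \<in> ?C" "s + 3 * \<delta> + \<Delta> \<le> t" for i t
    unfolding echo_quorum_stage_authors
  proof (rule unanimous_quorum_reached[where p = "echo_stage v" and K = "Echo v"
        and b = "s + 2 * \<delta> + \<Delta>", OF resilience(2,3) ch that(1) echo_unanimous echo_sent])
    show "GST \<le> s + 2 * \<delta> + \<Delta>" "s + 2 * \<delta> + \<Delta> + \<delta> \<le> t"
      using after_GST delays that(2) by linarith+
  qed
  have ready_sent: "\<exists>u m. (u, m) \<in> bcast X i \<and> ready_stage v m \<and> u \<le> s + 3 * \<delta> + \<Delta>"
    and ready_unanimous: "(u, m) \<in> bcast X i \<Longrightarrow> ready_stage v m \<Longrightarrow> \<exists>g. m = Ready v g (C, T)"
    if i: "i \<in> ?C" for i u m
  proof -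
    obtain e where e: "enter_at X v i = Some e" "s \<le> e"
      using enter[OF i] by blast
    \<comment> \<open>The second inequality is an equality for \<open>e = s\<close> and
      \<open>\<delta> = \<Delta>\<close>, so \<open>theta_R\<close> leaves no slack there.\<close>
    have "GST \<le> e" "s + 3 * \<delta> + \<Delta> \<le> e + 4 * \<Delta>"
      using e after_GST delays by linarith+
    note ready = ready_response_in_time[OF rules(2,5)[OF i] e(1) this
        echo_unique[OF i] echo_reached[OF i]]
    show "\<exists>u m. (u, m) \<in> bcast X i \<and> ready_stage v m \<and> u \<le> s + 3 * \<delta> + \<Delta>"
      by (rule ready(1))
    show "(u, m) \<in> bcast X i \<Longrightarrow> ready_stage v m \<Longrightarrow> \<exists>g. m = Ready v g (C, T)"
      by (rule ready(2))
  qed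
  have "\<exists>t \<le> s + 4 * \<delta> + \<Delta>. complete_at X v i = Some (t, C, T)" if i: "i \<in> ?C" for i
  proof -
    let ?t = "s + 4 * \<delta> + \<Delta>"
    have "ready_quorum (n - f) v (inbox X i ?t) (C, T)"
      unfolding ready_quorum_stage_authors
    proof (rule unanimous_quorum_reached[where p = "ready_stage v" and K = "Ready v"
          and b = "s + 3 * \<delta> + \<Delta>", OF resilience(2,3) ch i ready_unanimous ready_sent])
      show "GST \<le> s + 3 * \<delta> + \<Delta>" "s + 3 * \<delta> + \<Delta> + \<delta> \<le> ?t"
        using after_GST delays by linarith+
    qed
    \<comment> \<open>The existing quorum only bounds the completion time; the value returned may
      come from an earlier quorum for some \<open>B\<close>, which uniqueness then
      identifies.\<close>
    then obtain u B where B: "complete_at X v i = Some (u, B)" "u \<le> ?t"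
        "ready_quorum (n - f) v (inbox X i u) B"
      using rules(6)[OF i] unfolding rule_R4_def prompt_once_def
      by (metis elem_set)
    have "n - f \<le> card (stage_authors (ready_stage v) (Ready v)
        (take (length (inbox X i u)) (inbox X i u)) B)"
      using B(3) unfolding ready_quorum_stage_authors by simp
    then have "B = (C, T)"
      by (rule unanimous_quorum_unique[where p = "ready_stage v" and K = "Ready v",
            OF resilience ch i _ ready_unanimous, rotated -1]) simp_all
    then show ?thesis
      using B by blast
  qed
  then show ?thesis
    using delays by auto
qed

end
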